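(* For all integers $m\ge 3$ and $k\ge 3$, the linear homogeneous equation in $m$ variables $$x_1+x_2+\dots+x_{m-1}=\left\lceil (m-1)^{\frac{k-1}{k-2}}\right\rceil x_m$$ is not $k$-regular. In particular, for all $m,k\ge 3$ there exists a linear homogeneous equation in $m$ variables that is not $k$-regular.
   Context: A linear equation $\mathcal{E}$ is $k$-regular if every coloring of the positive integers $\mathbb{N}$ with $k$ colors admits a monochromatic solution to $\mathcal{E}$ in positive integers (equivalently, the $k$-color Rado number $R_k(\mathcal{E})$, the least $n$ such that every $k$-coloring of $\{1,\dots,n\}$ has a monochromatic solution in $\{1,\dots,n\}$, is finite). *)

theory Defs
  imports Complex_Main
begin

text \<open>\<open>Lin_Eq m a c\<close> stands for the equation \<open>a 1 * x 1 + \<dots> + a m * x m = c\<close> with integer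
  coefficients; the values of \<open>a\<close> outside \<open>{1..m}\<close> are irrelevant.\<close>

datatype lin_eq = Lin_Eq (num_vars: nat) (coeff: "nat \<Rightarrow> int") (rhs: int)

definition pos_solution :: "lin_eq \<Rightarrow> (nat \<Rightarrow> nat) \<Rightarrow> bool" where
  "pos_solution E x \<longleftrightarrow>
     (\<forall>i\<in>{1..num_vars E}. x i > 0) \<and>
     (\<Sum>i = 1..num_vars E. coeff E i * int (x i)) = rhs E"

text \<open>All variables must genuinely occur, i.e. have nonzero coefficients.\<close>

definition homogeneous_in :: "nat \<Rightarrow> lin_eq \<Rightarrow> bool" where
  "homogeneous_in m E \<longleftrightarrow>
     num_vars E = m \<and> rhs E = 0 \<and> (\<forall>i\<in>{1..m}. coeff E i \<noteq> 0)"

text \<open>Colors are \<open>0, \<dots>, k - 1\<close>, not all of which need to be used. The color of \<open>0\<close> is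
  irrelevant, and the values of a solution need not be distinct.\<close>

definition k_regular :: "nat \<Rightarrow> lin_eq \<Rightarrow> bool" where
  "k_regular k E \<longleftrightarrow>
     (\<forall>col :: nat \<Rightarrow> nat. (\<forall>n>0. col n < k) \<longrightarrow>
        (\<exists>x. pos_solution E x \<and> (\<exists>j. \<forall>i\<in>{1..num_vars E}. col (x i) = j)))"

text \<open>The equation \<open>x 1 + \<dots> + x (m - 1) = c * x m\<close>, with all terms moved to the left.\<close>

definition sum_eq_multiple :: "nat \<Rightarrow> int \<Rightarrow> lin_eq" where
  "sum_eq_multiple m c = Lin_Eq m (\<lambda>i. if i = m then - c else 1) 0"

lemma pos_solution_sum_eq_multiple:
  assumes "m \<ge> 1"
  shows "pos_solution (sum_eq_multiple m c) x \<longleftrightarrow>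
           (\<forall>i\<in>{1..m}. x i > 0) \<and> (\<Sum>i = 1..m - 1. int (x i)) = c * int (x m)"
proof -
  from assms obtain n where m: "m = Suc n" by (cases m) auto
  have "(\<Sum>i = 1..n. (if i = m then - c else 1) * int (x i)) = (\<Sum>i = 1..n. int (x i))"
    by (rule sum.cong) (auto simp: m)
  then show ?thesis
    by (auto simp: pos_solution_def sum_eq_multiple_def m)
qed

lemma homogeneous_in_sum_eq_multiple:
  "c \<noteq> 0 \<Longrightarrow> homogeneous_in m (sum_eq_multiple m c)"
  by (simp add: homogeneous_in_def sum_eq_multiple_def)

end

(* Color n by the residue mod k of floor (log r n), where r = c / (m - 1) > 1. In a solution the
   largest of x 1, ..., x (m - 1) is at least r * x m and less than c * x m, and the hypothesis
   on c says exactly that c <= r ^ (k - 1). So the floors of the logarithms of these two values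
   differ by at least 1 and at most k - 1. *)
theory Submission
  imports Defs
begin

text \<open>Some summand is at least the average of the \<open>m - 1\<close> summands, stated here
  with the denominator cleared. Since \<open>m \<ge> 3\<close> leaves at least one further positive
  summand, no single one exhausts the total.\<close>

lemma sum_eq_multiple_large_term:
  fixes x :: "nat \<Rightarrow> nat"
  assumes "m \<ge> 3" and sol: "pos_solution (sum_eq_multiple m c) x"
  obtains i where "i \<in> {1..m - 1}" "c * int (x m) \<le> (int m - 1) * int (x i)"
    "int (x i) < c * int (x m)"
proof -
  have pos: "\<forall>i\<in>{1..m}. x i > 0" and eq: "(\<Sum>i = 1..m - 1. int (x i)) = c * int (x m)"
    using sol assms(1) by (auto simp: pos_solution_sum_eq_multiple)
  have "\<exists>i\<in>{1..m - 1}. c * int (x m) \<le> (int m - 1) * int (x i)"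
  proof (rule ccontr)
    assume "\<not> ?thesis"
    then have "(\<Sum>i = 1..m - 1. (int m - 1) * int (x i)) < (\<Sum>i = 1..m - 1. c * int (x m))"
      using assms(1) by (intro sum_strict_mono) (auto simp: not_le)
    then show False
      using assms(1) eq by (simp add: of_nat_diff flip: sum_distrib_left)
  qed
  then obtain i where i: "i \<in> {1..m - 1}" "c * int (x m) \<le> (int m - 1) * int (x i)"
    by blast
  have "(\<Sum>j \<in> {1..m - 1} - {i}. int (x j)) > 0"
  proof (rule sum_pos)
    \<comment> \<open>An index different from \<open>i\<close>; it lies in the range because
      \<open>m - 1 \<ge> 2\<close>.\<close>
    have "(if i = 1 then 2 else 1) \<in> {1..m - 1} - {i}"
      using assms(1) by auto
    then show "{1..m - 1} - {i} \<noteq> {}" by blast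
  qed (use pos in auto)
  moreover have "(\<Sum>j = 1..m - 1. int (x j)) = int (x i) + (\<Sum>j \<in> {1..m - 1} - {i}. int (x j))"
    using i(1) by (simp add: sum.remove)
  ultimately show thesis
    using that i eq by simp
qed

text \<open>Hypothesis \<open>pow\<close> is \<open>c \<le> r ^ (k - 1)\<close> for
  \<open>r = c / (m - 1)\<close>, with denominators cleared and one factor \<open>c\<close>
  cancelled, so that only natural exponents occur.\<close>

lemma not_k_regular_sum_eq_multiple:
  fixes c :: int
  assumes m: "m \<ge> 3" and k: "k \<ge> 2" and c: "int m - 1 < c"
    and pow: "(real m - 1) ^ (k - 1) \<le> real_of_int c ^ (k - 2)"
  shows "\<not> k_regular k (sum_eq_multiple m c)"
proof
  define r where "r = real_of_int c / (real m - 1)"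
  \<comment> \<open>For \<open>k > 0\<close> the integer residue is nonnegative, so
    \<open>nat\<close> loses no information and equal colors mean congruent floors.\<close>
  define col where "col n = nat (\<lfloor>log r (real n)\<rfloor> mod int k)" for n
  have c': "real m - 1 < real_of_int c"
    using c by linarith
  have c_pos: "real_of_int c > 0"
    using c' m by linarith
  have r1: "r > 1"
    using m c' by (simp add: r_def)
  have "real_of_int c * (real m - 1) ^ (k - 1) \<le> real_of_int c * real_of_int c ^ (k - 2)"
    using pow c_pos by simp
  also have "\<dots> = real_of_int c ^ (k - 1)"
    using k by (simp flip: power_Suc add: Suc_diff_Suc numeral_2_eq_2)
  finally have "real_of_int c \<le> r ^ (k - 1)"
    using m by (simp add: r_def power_divide field_simps)
  then have log_c: "log r (real_of_int c) \<le> real k - 1"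
    using r1 c_pos k by (simp add: log_le_iff powr_realpow[symmetric] of_nat_diff)
  have num_vars: "num_vars (sum_eq_multiple m c) = m"
    by (simp add: sum_eq_multiple_def)
  assume "k_regular k (sum_eq_multiple m c)"
  moreover have "col n < k" for n
    using k by (simp add: col_def nat_less_iff)
  ultimately obtain x j where sol: "pos_solution (sum_eq_multiple m c) x"
    and mono: "\<forall>i\<in>{1..m}. col (x i) = j"
    unfolding k_regular_def num_vars by blast
  obtain i where i: "i \<in> {1..m - 1}" and ge: "c * int (x m) \<le> (int m - 1) * int (x i)"
    and less: "int (x i) < c * int (x m)"
    using sum_eq_multiple_large_term[OF m sol] by blast
  have pos: "x i > 0" "x m > 0"
    using sol i m by (auto simp: pos_solution_sum_eq_multiple)
  have "real_of_int c * real (x m) \<le> (real m - 1) * real (x i)"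
    using ge by (simp flip: of_int_le_iff[where 'a = real])
  then have "r * real (x m) \<le> real (x i)"
    using m by (simp add: r_def field_simps)
  then have "log r (r * real (x m)) \<le> log r (real (x i))"
    using r1 pos by simp
  then have lower: "log r (real (x m)) + 1 \<le> log r (real (x i))"
    using r1 pos by (simp add: log_mult)
  have "real (x i) < real_of_int c * real (x m)"
    using less by (simp flip: of_int_less_iff[where 'a = real])
  then have "log r (real (x i)) < log r (real_of_int c * real (x m))"
    using r1 pos c_pos by simp
  then have upper: "log r (real (x i)) < log r (real (x m)) + (real k - 1)"
    using r1 pos c_pos log_c by (simp add: log_mult)
  define d where "d = \<lfloor>log r (real (x i))\<rfloor> - \<lfloor>log r (real (x m))\<rfloor>"
  \<comment> \<open>The two logarithms differ by at least 1 and by less than \<open>k - 1\<close>;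
    taking floors changes the difference by less than 1.\<close>
  have "d > 0" "d < int k"
    using lower upper unfolding d_def by linarith+
  moreover have "col (x i) = col (x m)"
    using mono i m by auto
  then have "int k dvd d"
    using k by (simp add: col_def d_def mod_eq_dvd_iff eq_nat_nat_iff)
  ultimately show False
    using zdvd_not_zless by blast
qed

theorem theorem6:
  fixes m k :: nat
  assumes "m \<ge> 3" and "k \<ge> 3"
  shows "\<not> k_regular k
           (sum_eq_multiple m \<lceil>(real m - 1) powr ((real k - 1) / (real k - 2))\<rceil>) \<and>
         (\<exists>E. homogeneous_in m E \<and> \<not> k_regular k E)"
proof -
  define e where "e = (real k - 1) / (real k - 2)"
  define c where "c = \<lceil>(real m - 1) powr e\<rceil>"
  have c_ge: "(real m - 1) powr e \<le> real_of_int c"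
    by (simp add: c_def)
  have "e > 1"
    using assms by (simp add: e_def)
  \<comment> \<open>The base exceeds 1, so \<open>e > 1\<close> makes \<open>c\<close> exceed
    \<open>m - 1\<close>; this gives \<open>r > 1\<close> in the coloring.\<close>
  then have "(real m - 1) powr 1 < (real m - 1) powr e"
    using assms by (intro powr_less_mono) auto
  then have c_gt: "int m - 1 < c"
    using c_ge assms by simp
  \<comment> \<open>The exponent is chosen so that \<open>e * (k - 2) = k - 1\<close>; rounding up
    to \<open>c\<close> then only enlarges the right-hand side.\<close>
  have "(real m - 1) ^ (k - 1) = ((real m - 1) powr e) ^ (k - 2)"
    using assms by (simp add: powr_realpow[symmetric] powr_powr of_nat_diff e_def)
  also have "\<dots> \<le> real_of_int c ^ (k - 2)"
    using c_ge by (intro power_mono) auto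
  finally have "\<not> k_regular k (sum_eq_multiple m c)"
    using assms c_gt by (intro not_k_regular_sum_eq_multiple) auto
  moreover have "homogeneous_in m (sum_eq_multiple m c)"
    using c_gt assms by (intro homogeneous_in_sum_eq_multiple) auto
  ultimately show ?thesis
    unfolding c_def e_def by blast
qed

end
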